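(* Letting $n\to\infty$ through the even integers, $$\lim_{n\to\infty}\frac{C_{\mathbb{R},n}}{C_{\mathbb{R},n-2}}=2^{\frac14}\cdot\lim_{n\to\infty}\frac{r_n}{r_{n-2}},$$ in the sense that one limit exists if and only if the other does, and then the equality holds. In particular, if the sequence $\{r_n\}$ (indexed by the even positive integers) is convergent, then, with $n\to\infty$ through all integers, $$\lim_{n\to\infty}\frac{C_{\mathbb{R},n}}{C_{\mathbb{R},n-1}}=2^{\frac18}.$$
   Context: For $p>0$ put $A_p=\sqrt{2}\left(\frac{\Gamma((p+1)/2)}{\sqrt{\pi}}\right)^{1/p}$, where $\Gamma$ is the Gamma function. The real numbers $C_{\mathbb{R},n}$, $n\ge 2$ (estimates for the constants in the real Bohnenblust--Hille inequality), are defined recursively by $C_{\mathbb{R},2}=2^{1/2}$, $C_{\mathbb{R},3}=2^{5/6}$, and $$C_{\mathbb{R},n}=2^{\frac12}\left(\frac{C_{\mathbb{R},n-2}}{A_{\frac{2n-4}{n-1}}^{2}}\right)^{\frac{n-2}{n}}\quad\text{for } n>3.$$ For even positive integers $n$ define $$r_n=\frac{1}{2^{\frac{n-2}{4}}\left[\prod_{k=1}^{\frac{n-2}{2}}\left(\frac{\Gamma\left(\frac{6k+1}{4k+2}\right)}{\sqrt{\pi}}\right)^{2k+1}\right]^{1/n}}$$ (an empty product equals $1$). *)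

theory Defs
  imports "HOL-Analysis.Analysis"
begin

definition BH_A :: "real \<Rightarrow> real" where
  "BH_A p = sqrt 2 * (Gamma ((p + 1) / 2) / sqrt pi) powr (1 / p)"

text \<open>The value 0 for \<open>n < 2\<close> is a dummy: the constants are defined for \<open>n \<ge> 2\<close> only,
  and the recursion started at some \<open>n > 3\<close> never reaches it.\<close>

fun BH_C :: "nat \<Rightarrow> real" where
  "BH_C n =
    (if n < 2 then 0
     else if n = 2 then 2 powr (1 / 2)
     else if n = 3 then 2 powr (5 / 6)
     else 2 powr (1 / 2) *
       (BH_C (n - 2) / (BH_A ((2 * real n - 4) / (real n - 1)))\<^sup>2) powr ((real n - 2) / real n))"

declare BH_C.simps [simp del]

text \<open>Meaningful for even \<open>n \<ge> 2\<close> only.\<close>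

definition BH_r :: "nat \<Rightarrow> real" where
  "BH_r n = 1 / (2 powr ((real n - 2) / 4) *
     (\<Prod>k = 1..(n - 2) div 2.
        (Gamma ((6 * real k + 1) / (4 * real k + 2)) / sqrt pi) ^ (2 * k + 1)) powr (1 / real n))"

end

theory Submission imports Defs "HOL-Real_Asymp.Real_Asymp" begin

text \<open>
  Write \<open>L n = n * ln (C n)\<close> and \<open>h x = ln (\<Gamma>(3/2 - x) / \<surd>\<pi>)\<close>. Taking logarithms, the recursion
  becomes \<open>L n = L (n - 2) + (2 - n/2) ln 2 - (n - 1) h (1/(n - 1))\<close>. For even \<open>n\<close> it telescopes
  to \<open>C (2m) = 2 powr ((m + 1)/4) * r (2m)\<close>, so the two quotients agree up to the factor
  \<open>2 powr (1/4)\<close>. Moreover \<open>h\<close> is differentiable at \<open>0\<close> with \<open>h 0 = -ln 2\<close>, hence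
  \<open>L n - (n\<^sup>2/8) ln 2\<close> has convergent increments of step two, and by Cesaro averaging
  \<open>ln (C n) - (n/8) ln 2\<close> converges along all \<open>n\<close>.
\<close>

section \<open>The logarithm of the Gamma factor near 3/2\<close>

text \<open>This is the \<open>h\<close> above. It serves both sides: the Gamma arguments in
  \<open>BH_A\<close> at \<open>n\<close> and in the \<open>k\<close>-th factor of
  \<open>BH_r\<close> are \<open>3/2 - x\<close> with \<open>x = 1/(n - 1)\<close> and
  \<open>x = 1/(2k + 1)\<close>, which agree for \<open>n = 2k + 2\<close>.\<close>

definition log_Gamma_shift :: "real \<Rightarrow> real" where
  "log_Gamma_shift x = ln (Gamma (3 / 2 - x) / sqrt pi)"

lemma Gamma_three_halves: "Gamma (3 / 2 :: real) = sqrt pi / 2"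
proof -
  have "(1 / 2 :: real) \<notin> \<int>\<^sub>\<le>\<^sub>0" by (auto elim!: nonpos_Ints_cases)
  from Gamma_plus1[OF this] show ?thesis by (simp add: Gamma_one_half_real)
qed

lemma log_Gamma_shift_0: "log_Gamma_shift 0 = - ln 2"
  by (simp add: log_Gamma_shift_def Gamma_three_halves ln_div)

lemma log_Gamma_shift_differentiable:
  "\<exists>D. (log_Gamma_shift has_field_derivative D) (at 0)"
proof -
  have "(3 / 2 :: real) \<notin> \<int>\<^sub>\<le>\<^sub>0" by (auto elim!: nonpos_Ints_cases)
  moreover have "Gamma (3 / 2 :: real) > 0" by simp
  ultimately show ?thesis
    unfolding log_Gamma_shift_def[abs_def]
    by (intro exI) (rule derivative_eq_intros refl | simp)+
qed

text \<open>As \<open>h 0 = -ln 2\<close>, this is the difference quotient of \<open>h\<close> at 0,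
  taken along \<open>x = 1/(n - 1)\<close>.\<close>

lemma log_Gamma_shift_increment:
  "\<exists>D. (\<lambda>n. (real n - 1) * (log_Gamma_shift (1 / (real n - 1)) + ln 2)) \<longlonglongrightarrow> D"
proof -
  obtain D where D: "(log_Gamma_shift has_field_derivative D) (at 0)"
    using log_Gamma_shift_differentiable by blast
  have "filterlim (\<lambda>n. 1 / (real n - 1)) (at 0) sequentially"
    unfolding filterlim_at
  proof
    \<comment> \<open>The filter \<open>at 0\<close> excludes 0 itself, and \<open>1 / 0 = 0\<close>
      would hit it at \<open>n = 1\<close>.\<close>
    show "\<forall>\<^sub>F n in sequentially. 1 / (real n - 1) \<in> UNIV \<and> 1 / (real n - 1) \<noteq> 0"
      using eventually_ge_at_top[of 2] by eventually_elim auto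
    show "(\<lambda>n. 1 / (real n - 1)) \<longlonglongrightarrow> 0" by real_asymp
  qed
  from filterlim_compose[OF D[unfolded DERIV_def] this] show ?thesis
    by (auto simp: log_Gamma_shift_0 mult.commute)
qed

section \<open>The recursion in logarithmic form\<close>

lemma BH_A_pos:
  assumes "p > 0"
  shows "BH_A p > 0"
proof -
  have "Gamma ((p + 1) / 2) > 0" using assms by (intro Gamma_real_pos) simp
  then show ?thesis unfolding BH_A_def by simp
qed

text \<open>The factor \<open>2 * (n - 2)\<close> clears the exponent
  \<open>1/p = (n - 1) / (2 * (n - 2))\<close>; it is also the weight of \<open>ln A\<close> once
  the recursion is multiplied by \<open>n\<close>.\<close>

lemma ln_BH_A:
  assumes "n \<ge> 4"
  shows "2 * (real n - 2) * ln (BH_A ((2 * real n - 4) / (real n - 1)))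
    = (real n - 2) * ln 2 + (real n - 1) * log_Gamma_shift (1 / (real n - 1))"
proof -
  define p where "p = (2 * real n - 4) / (real n - 1)"
  have n: "real n \<ge> 4" using assms by simp
  have p: "p > 0" using n by (simp add: p_def)
  have "(p + 1) / 2 = 3 / 2 - 1 / (real n - 1)" using n by (simp add: p_def field_simps)
  moreover have "Gamma ((p + 1) / 2) \<noteq> 0"
    using p Gamma_real_pos[of "(p + 1) / 2"] by force
  ultimately have "ln (BH_A p) = ln 2 / 2 + (1 / p) * log_Gamma_shift (1 / (real n - 1))"
    unfolding BH_A_def log_Gamma_shift_def by (simp only:) (simp add: ln_mult ln_powr ln_sqrt)
  moreover have "1 / p = (real n - 1) / (2 * (real n - 2))" using n by (simp add: p_def field_simps)
  ultimately show ?thesis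
    using n unfolding p_def[symmetric] by (simp add: field_simps)
qed

lemma BH_C_pos: "n \<ge> 2 \<Longrightarrow> BH_C n > 0"
proof (induction n rule: less_induct)
  case (less n)
  show ?case
  proof (cases "n \<le> 3")
    case True
    then show ?thesis using less.prems by (subst BH_C.simps) auto
  next
    case False
    then have "BH_C (n - 2) > 0" "BH_A ((2 * real n - 4) / (real n - 1)) > 0"
      using less.IH[of "n - 2"] by (auto intro!: BH_A_pos)
    then show ?thesis using False by (subst BH_C.simps) simp
  qed
qed

text \<open>Multiplying by \<open>n\<close> clears the exponent \<open>(n - 2)/n\<close>, which
  makes the recursion additive.\<close>

lemma ln_BH_C_rec:
  assumes "n \<ge> 4"
  shows "real n * ln (BH_C n) = real (n - 2) * ln (BH_C (n - 2))
    + (2 - real n / 2) * ln 2 - (real n - 1) * log_Gamma_shift (1 / (real n - 1))"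
proof -
  let ?A = "BH_A ((2 * real n - 4) / (real n - 1))"
  have n: "real n \<ge> 4" using assms by simp
  have pos: "BH_C (n - 2) > 0" "?A > 0"
    using assms by (auto intro!: BH_C_pos BH_A_pos)
  have "BH_C n = 2 powr (1 / 2) * (BH_C (n - 2) / ?A\<^sup>2) powr ((real n - 2) / real n)"
    using assms by (subst BH_C.simps) auto
  then have "ln (BH_C n) = ln 2 / 2 + (real n - 2) / real n * (ln (BH_C (n - 2)) - 2 * ln ?A)"
    using pos by (simp add: ln_mult ln_powr ln_div ln_realpow)
  then have "real n * ln (BH_C n)
      = real n / 2 * ln 2 + (real n - 2) * ln (BH_C (n - 2)) - 2 * (real n - 2) * ln ?A"
    using n by (simp add: field_simps)
  then show ?thesis
    using ln_BH_A[OF assms] assms by (simp add: of_nat_diff algebra_simps)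
qed

section \<open>Even indices: comparison with \<open>BH_r\<close>\<close>

lemma BH_r_pos: "BH_r n > 0"
proof -
  define P where "P = (\<Prod>k = 1..(n - 2) div 2.
      (Gamma ((6 * real k + 1) / (4 * real k + 2)) / sqrt pi) ^ (2 * k + 1))"
  have "P > 0" unfolding P_def by (intro prod_pos ballI) (simp add: Gamma_real_pos)
  then show ?thesis unfolding BH_r_def P_def[symmetric] by simp
qed

text \<open>The \<open>k\<close>-th summand is the Gamma term of the recursion at
  \<open>n = 2k + 2\<close>, so the two sums cancel when compared.\<close>

lemma ln_BH_r:
  assumes "m \<ge> 1"
  shows "2 * real m * ln (BH_r (2 * m)) = - real m * (real m - 1) * ln 2
    - (\<Sum>k = 1..<m. (2 * real k + 1) * log_Gamma_shift (1 / (2 * real k + 1)))"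
proof -
  let ?G = "\<lambda>k. Gamma ((6 * real k + 1) / (4 * real k + 2)) / sqrt pi"
  have G: "?G k > 0" for k by (simp add: Gamma_real_pos)
  have I: "{1..(2 * m - 2) div 2} = {1..<m}" by auto
  have "(6 * real k + 1) / (4 * real k + 2) = 3 / 2 - 1 / (2 * real k + 1)" for k
  proof -
    have "2 * real k + 1 > 0" "4 * real k + 2 > 0" by simp_all
    then show ?thesis by (simp add: divide_simps)
  qed
  then have lnG: "ln (?G k) = log_Gamma_shift (1 / (2 * real k + 1))" for k
    by (simp only: log_Gamma_shift_def)
  define P where "P = (\<Prod>k = 1..<m. ?G k ^ (2 * k + 1))"
  have P: "P > 0" unfolding P_def using G by (intro prod_pos ballI zero_less_power)
  have "ln P = (\<Sum>k = 1..<m. ln (?G k ^ (2 * k + 1)))"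
    unfolding P_def using G
    by (intro ln_prod power_not_zero) (simp_all add: less_imp_neq[symmetric])
  also have "\<dots> = (\<Sum>k = 1..<m. (2 * real k + 1) * log_Gamma_shift (1 / (2 * real k + 1)))"
    by (intro sum.cong refl, subst ln_realpow, subst lnG) simp
  finally have lnP: "ln P = \<dots>" .
  have "ln (BH_r (2 * m)) = - ((2 * real m - 2) / 4 * ln 2 + 1 / (2 * real m) * ln P)"
    unfolding BH_r_def I P_def[symmetric] using P
    by (simp add: ln_div ln_mult ln_powr)
  then show ?thesis
    unfolding lnP[symmetric] using assms by (simp add: field_simps)
qed

lemma BH_C_even_eq:
  assumes "m \<ge> 1"
  shows "BH_C (2 * m) = 2 powr ((real m + 1) / 4) * BH_r (2 * m)"
proof -
  have "2 * real m * ln (BH_C (2 * m))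
      = 2 * real m * ln (BH_r (2 * m)) + real m * (real m + 1) / 2 * ln 2"
    using assms
  proof (induction m rule: dec_induct)
    case base
    have "BH_C 2 = 2 powr (1 / 2)" by (subst BH_C.simps) simp
    then show ?case using ln_BH_r[of 1] by (simp add: ln_powr)
  next
    case (step m)
    \<comment> \<open>With \<open>n = 2m + 2\<close>, the coefficient \<open>2 - n/2\<close> is
      \<open>1 - m\<close> and \<open>n - 1\<close> is \<open>2m + 1\<close>.\<close>
    have "2 * real (Suc m) * ln (BH_C (2 * Suc m)) = 2 * real m * ln (BH_C (2 * m))
        + (1 - real m) * ln 2 - (2 * real m + 1) * log_Gamma_shift (1 / (2 * real m + 1))"
      using ln_BH_C_rec[of "2 * Suc m"] step.hyps by (simp add: algebra_simps add_divide_distrib)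
    then show ?case
      using step.IH step.hyps ln_BH_r[of m] ln_BH_r[of "Suc m"]
      by (simp add: algebra_simps add_divide_distrib)
  qed
  then have "2 * real m * ln (BH_C (2 * m))
      = 2 * real m * (ln (BH_r (2 * m)) + (real m + 1) / 4 * ln 2)"
    by (simp add: field_simps)
  then have "ln (BH_C (2 * m)) = ln (BH_r (2 * m)) + (real m + 1) / 4 * ln 2"
    using assms by simp
  also have "\<dots> = ln (2 powr ((real m + 1) / 4) * BH_r (2 * m))"
    using BH_r_pos[of "2 * m"] by (simp add: ln_mult ln_powr)
  finally show ?thesis
    using BH_r_pos[of "2 * m"] BH_C_pos[of "2 * m"] assms by (subst (asm) ln_inj_iff) auto
qed

text \<open>The identity fails at \<open>m = 1\<close>: there \<open>BH_C 0\<close> is the dummy 0,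
  so the left side is 0 while the right side is positive.\<close>

lemma BH_C_even_ratio:
  assumes "m \<ge> 2"
  shows "BH_C (2 * m) / BH_C (2 * m - 2) = 2 powr (1 / 4) * (BH_r (2 * m) / BH_r (2 * m - 2))"
proof -
  have m: "2 * m - 2 = 2 * (m - 1)" by simp
  have "2 powr ((real m + 1) / 4) = 2 powr (1 / 4) * 2 powr ((real (m - 1) + 1) / 4)"
    using assms by (subst powr_add[symmetric]) (simp add: of_nat_diff field_simps)
  then show ?thesis
    unfolding m using assms by (simp add: BH_C_even_eq)
qed

section \<open>Cesaro averaging with step two\<close>

text \<open>Once the increments are below \<open>e/2\<close>, \<open>d\<close> grows at most
  linearly with slope \<open>e/2\<close>, up to a constant that division by \<open>n\<close>
  removes.\<close>

lemma Cesaro_step_two_zero: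
  fixes d :: "nat \<Rightarrow> real"
  assumes "(\<lambda>n. d n - d (n - 2)) \<longlonglongrightarrow> 0"
  shows "(\<lambda>n. d n / real n) \<longlonglongrightarrow> 0"
proof (rule LIMSEQ_I)
  fix e :: real assume e: "e > 0"
  obtain N where N: "\<And>n. n \<ge> N \<Longrightarrow> \<bar>d n - d (n - 2)\<bar> < e / 2"
    using LIMSEQ_D[OF assms, of "e / 2"] e by auto
  \<comment> \<open>Steps of two preserve parity, so each parity class needs its own starting
    value.\<close>
  define B where "B = \<bar>d N\<bar> + \<bar>d (Suc N)\<bar>"
  have bound: "n \<ge> N \<Longrightarrow> \<bar>d n\<bar> \<le> B + e / 2 * real n" for n
  proof (induction n rule: less_induct)
    case (less n)
    show ?case
    proof (cases "n = N \<or> n = Suc N")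
      case True
      then have "\<bar>d n\<bar> \<le> B" by (auto simp: B_def)
      moreover have "0 \<le> e / 2 * real n" using e by simp
      ultimately show ?thesis by linarith
    next
      case False
      then have "n \<ge> N + 2" using less.prems by simp
      then have "\<bar>d (n - 2)\<bar> \<le> B + e / 2 * real (n - 2)" by (intro less.IH) auto
      moreover have "e / 2 * real (n - 2) = e / 2 * real n - e"
        using \<open>n \<ge> N + 2\<close> by (simp add: of_nat_diff field_simps)
      moreover have "\<bar>d n - d (n - 2)\<bar> < e / 2" using N less.prems by blast
      ultimately show ?thesis using e by linarith
    qed
  qed
  \<comment> \<open>Beyond \<open>M\<close> the constant \<open>B\<close> costs less than the other
    half of \<open>e * n\<close>.\<close>
  obtain M where M: "real M > 2 * B / e" using reals_Archimedean2 by blast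
  show "\<exists>no. \<forall>n\<ge>no. norm (d n / real n - 0) < e"
  proof (intro exI allI impI)
    fix n assume n: "n \<ge> Suc (max N M)"
    then have "real n > 2 * B / e" using M by linarith
    then have "B < e / 2 * real n" using e by (simp add: field_simps)
    moreover have "\<bar>d n\<bar> \<le> B + e / 2 * real n" using bound n by simp
    ultimately have "\<bar>d n\<bar> < e * real n" by simp
    then show "norm (d n / real n - 0) < e" using n by (simp add: field_simps)
  qed
qed

text \<open>The linear function \<open>K/2 * n\<close> has step-two increment \<open>K\<close>;
  subtracting it reduces to limit 0.\<close>

lemma Cesaro_step_two:
  fixes a :: "nat \<Rightarrow> real"
  assumes "(\<lambda>n. a n - a (n - 2)) \<longlonglongrightarrow> K"
  shows "(\<lambda>n. a n / real n) \<longlonglongrightarrow> K / 2"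
proof -
  define d where "d n = a n - K / 2 * real n" for n
  have "(\<lambda>n. a n - a (n - 2) - K) \<longlonglongrightarrow> K - K" by (intro tendsto_intros assms)
  moreover have "\<forall>\<^sub>F n in sequentially. a n - a (n - 2) - K = d n - d (n - 2)"
    using eventually_ge_at_top[of 2]
    by eventually_elim (simp add: d_def of_nat_diff field_simps)
  ultimately have "(\<lambda>n. d n - d (n - 2)) \<longlonglongrightarrow> 0"
    by (simp add: tendsto_cong)
  then have "(\<lambda>n. d n / real n + K / 2) \<longlonglongrightarrow> 0 + K / 2"
    by (intro tendsto_intros Cesaro_step_two_zero)
  moreover have "\<forall>\<^sub>F n in sequentially. d n / real n + K / 2 = a n / real n"
    using eventually_gt_at_top[of 0]
    by eventually_elim (simp add: d_def field_simps)
  ultimately show ?thesis by (simp add: tendsto_cong)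
qed

section \<open>Growth of the constants and the limits\<close>

lemma ln_BH_C_asymp:
  "\<exists>c. (\<lambda>n. ln (BH_C n) - real n / 8 * ln 2) \<longlonglongrightarrow> c"
proof -
  define a where "a n = real n * ln (BH_C n) - (real n)\<^sup>2 / 8 * ln 2" for n
  obtain D where D: "(\<lambda>n. (real n - 1) * (log_Gamma_shift (1 / (real n - 1)) + ln 2)) \<longlonglongrightarrow> D"
    using log_Gamma_shift_increment by blast
  \<comment> \<open>Writing \<open>h\<close> as \<open>(h + ln 2) - ln 2\<close>, the coefficient of
    \<open>ln 2\<close> in the increment of \<open>a\<close> is
    \<open>(2 - n/2) + (n - 1) - (n - 1)/2 = 3/2\<close>, where the last term is the increment of
    \<open>n\<^sup>2/8\<close>.\<close>
  have "(\<lambda>n. 3 / 2 * ln 2 - (real n - 1) * (log_Gamma_shift (1 / (real n - 1)) + ln 2))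
      \<longlonglongrightarrow> 3 / 2 * ln 2 - D"
    by (intro tendsto_intros D)
  moreover have "\<forall>\<^sub>F n in sequentially.
      3 / 2 * ln 2 - (real n - 1) * (log_Gamma_shift (1 / (real n - 1)) + ln 2) = a n - a (n - 2)"
    using eventually_ge_at_top[of 4]
    by eventually_elim
      (simp add: a_def ln_BH_C_rec of_nat_diff power2_eq_square field_simps)
  ultimately have "(\<lambda>n. a n - a (n - 2)) \<longlonglongrightarrow> 3 / 2 * ln 2 - D"
    by (simp add: tendsto_cong)
  then have "(\<lambda>n. a n / real n) \<longlonglongrightarrow> (3 / 2 * ln 2 - D) / 2"
    by (rule Cesaro_step_two)
  moreover have "\<forall>\<^sub>F n in sequentially. a n / real n = ln (BH_C n) - real n / 8 * ln 2"
    using eventually_gt_at_top[of 0]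
    by eventually_elim (simp add: a_def power2_eq_square field_simps)
  ultimately show ?thesis by (auto simp: tendsto_cong)
qed

text \<open>Consecutive differences of the convergent \<open>f\<close> vanish in the limit, leaving
  only the increment \<open>ln 2 / 8\<close> of the linear term.\<close>

lemma BH_C_ratio_tendsto: "(\<lambda>n. BH_C n / BH_C (n - 1)) \<longlonglongrightarrow> 2 powr (1 / 8)"
proof -
  define f where "f n = ln (BH_C n) - real n / 8 * ln 2" for n
  obtain c where c: "f \<longlonglongrightarrow> c"
    using ln_BH_C_asymp unfolding f_def by blast
  have "(\<lambda>n. f (n - 1)) \<longlonglongrightarrow> c"
    by (rule LIMSEQ_offset[where k = 1]) (use c in simp)
  then have "(\<lambda>n. exp (f n - f (n - 1) + ln 2 / 8)) \<longlonglongrightarrow> exp (c - c + ln 2 / 8)"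
    by (intro tendsto_intros c)
  moreover have "\<forall>\<^sub>F n in sequentially.
      exp (f n - f (n - 1) + ln 2 / 8) = BH_C n / BH_C (n - 1)"
    \<comment> \<open>From 3 on, both \<open>n\<close> and \<open>n - 1\<close> are at least 2,
      where \<open>BH_C\<close> is positive and \<open>exp\<close> undoes \<open>ln\<close>.\<close>
    using eventually_ge_at_top[of 3]
  proof eventually_elim
    case (elim n)
    then have "f n - f (n - 1) + ln 2 / 8 = ln (BH_C n) - ln (BH_C (n - 1))"
      by (simp add: f_def of_nat_diff field_simps)
    then show ?case
      using elim BH_C_pos[of n] BH_C_pos[of "n - 1"] by (simp add: exp_diff)
  qed
  ultimately show ?thesis by (simp add: tendsto_cong powr_def)
qed

theorem theorem2p5:
  shows "(convergent (\<lambda>m. BH_C (2 * m) / BH_C (2 * m - 2)) \<longleftrightarrow>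
            convergent (\<lambda>m. BH_r (2 * m) / BH_r (2 * m - 2))) \<and>
         (convergent (\<lambda>m. BH_C (2 * m) / BH_C (2 * m - 2)) \<longrightarrow>
            lim (\<lambda>m. BH_C (2 * m) / BH_C (2 * m - 2)) =
              2 powr (1 / 4) * lim (\<lambda>m. BH_r (2 * m) / BH_r (2 * m - 2))) \<and>
         (convergent (\<lambda>m. BH_r (2 * m)) \<longrightarrow>
            (\<lambda>n. BH_C n / BH_C (n - 1)) \<longlonglongrightarrow> 2 powr (1 / 8))"
proof -
  let ?c = "\<lambda>m. BH_C (2 * m) / BH_C (2 * m - 2)"
  let ?r = "\<lambda>m. BH_r (2 * m) / BH_r (2 * m - 2)"
  \<comment> \<open>Convergence and limits depend only on tails, so the exceptional small
    \<open>m\<close> do no harm.\<close>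
  have eq: "\<forall>\<^sub>F m in sequentially. ?c m = 2 powr (1 / 4) * ?r m"
    using eventually_ge_at_top[of 2] by eventually_elim (rule BH_C_even_ratio)
  have "convergent ?c \<longleftrightarrow> convergent (\<lambda>m. 2 powr (1 / 4) * ?r m)"
    using eq by (rule convergent_cong)
  also have "\<dots> \<longleftrightarrow> convergent ?r"
    by (rule convergent_mult_const_iff) simp
  finally have conv: "convergent ?c \<longleftrightarrow> convergent ?r" .
  have "lim ?c = 2 powr (1 / 4) * lim ?r" if "convergent ?c"
  proof (rule limI)
    have "?r \<longlonglongrightarrow> lim ?r" using that conv by (simp add: convergent_LIMSEQ_iff)
    then have "(\<lambda>m. 2 powr (1 / 4) * ?r m) \<longlonglongrightarrow> 2 powr (1 / 4) * lim ?r"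
      by (intro tendsto_intros)
    then show "?c \<longlonglongrightarrow> 2 powr (1 / 4) * lim ?r"
      using eq by (simp only: tendsto_cong)
  qed
  with conv BH_C_ratio_tendsto show ?thesis by blast
qed

end
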